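(* Let $1\le t\le n$ and let $H: a_1x_1+\cdots+a_tx_t=b$ be a spanned hyperplane of $Q_n$, where $a_1,\dots,a_t,b$ are positive integers with $a_1\le a_2\le\cdots\le a_t$. Let $\alpha=(\alpha_1,\dots,\alpha_\ell)$ be the type of $H$. Then $$F(H)=P(H)\times B_{n,t},$$ where $P(H)=S_\alpha$ if $\sum_{i=1}^t a_i\neq 2b$ and $P(H)=S_\alpha\cup\overline{S}_\alpha$ if $\sum_{i=1}^t a_i=2b$, and $B_{n,t}$ is the group of all signed permutations of $\{t+1,\dots,n\}$.
   Context: $Q_n=[0,1]^n$, $V_n=\{0,1\}^n$. $B_n$ is the group of signed permutations $w$ of $\{1,\dots,n\}$ (underlying permutation $\pi$, sign $\pm$ on each $i$), acting on $\mathbb{R}^n$ by $w(x)_i=x_{\pi(i)}$ if $i$ has sign $+$ and $w(x)_i=1-x_{\pi(i)}$ if $i$ has sign $-$; $w$ acts on hyperplanes by taking images. A spanned hyperplane of $Q_n$ is a hyperplane $H$ such that the affine hull of $H\cap V_n$ is $H$, and $F(H)=\{w\in B_n:w(H)=H\}$. The type of $H$ is $\alpha=(\alpha_1,\dots,\alpha_\ell)$ with $\ell=a_t$, where $\alpha_i$ is the number of indices $j$ with $a_j=i$ (so $\alpha_i$ may be $0$). With $\alpha_0=0$, let $I_i=[\alpha_1+\cdots+\alpha_{i-1}+1,\ \alpha_1+\cdots+\alpha_i]$ for $1\le i\le\ell$; these intervals partition $\{1,\dots,t\}$. $S_\alpha=S_{\alpha_1}\times\cdots\times S_{\alpha_\ell}$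 is the Young subgroup of permutations of $\{1,\dots,t\}$ preserving each $I_i$, viewed as signed permutations with all signs $+$; $\overline{S}_\alpha$ is the set of signed permutations of $\{1,\dots,t\}$ whose underlying permutation lies in $S_\alpha$ and in which every element has sign $-$. The product $P(H)\times B_{n,t}$ is the set of signed permutations of $\{1,\dots,n\}$ obtained by combining an element of $P(H)$ on $\{1,\dots,t\}$ with an element of $B_{n,t}$ on $\{t+1,\dots,n\}$. *)

theory Defs
  imports
    "HOL-Analysis.Analysis"
    "HOL-Combinatorics.Permutations"
    "HOL-Library.Function_Algebras"
begin

text \<open>
  The dimension is a natural number variable, so a point of $R^n$ is a function on \<open>nat\<close>
  vanishing outside \<open>{1..n}\<close>. The following instance (pointwise scalar multiplication) makes
  the library's \<open>affine hull\<close> available for such functions.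
\<close>

instantiation "fun" :: (type, real_vector) real_vector
begin

definition scaleR_fun :: "real \<Rightarrow> ('a \<Rightarrow> 'b) \<Rightarrow> 'a \<Rightarrow> 'b" where
  "scaleR_fun c f = (\<lambda>x. c *\<^sub>R f x)"

instance
  by standard (simp_all add: scaleR_fun_def plus_fun_def scaleR_add_right scaleR_add_left)

end

definition Rn :: "nat \<Rightarrow> (nat \<Rightarrow> real) set" where
  "Rn n = {x. \<forall>i. i \<notin> {1..n} \<longrightarrow> x i = 0}"

definition cube_vertices :: "nat \<Rightarrow> (nat \<Rightarrow> real) set" where
  "cube_vertices n = {x \<in> Rn n. \<forall>i\<in>{1..n}. x i \<in> {0, 1}}"

definition hyperplane :: "nat \<Rightarrow> (nat \<Rightarrow> real) set \<Rightarrow> bool" where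
  "hyperplane n H \<longleftrightarrow>
     (\<exists>c d. (\<exists>i\<in>{1..n}. c i \<noteq> 0) \<and> H = {x \<in> Rn n. (\<Sum>i = 1..n. c i * x i) = d})"

definition spanned_hyperplane :: "nat \<Rightarrow> (nat \<Rightarrow> real) set \<Rightarrow> bool" where
  "spanned_hyperplane n H \<longleftrightarrow> hyperplane n H \<and> affine hull (H \<inter> cube_vertices n) = H"

text \<open>
  A signed permutation of \<open>A\<close> is a pair \<open>(\<pi>, N)\<close>: \<open>\<pi>\<close> is the underlying permutation and \<open>N\<close>
  the set of the elements with sign $-$. As \<open>\<pi>\<close> is the identity outside \<open>A\<close> and \<open>N \<subseteq> A\<close>,
  distinct pairs are distinct signed permutations.
\<close>

type_synonym signed_perm = "(nat \<Rightarrow> nat) \<times> nat set"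

definition signed_perms :: "nat set \<Rightarrow> signed_perm set" where
  "signed_perms A = {(\<pi>, N). \<pi> permutes A \<and> N \<subseteq> A}"

definition act :: "nat \<Rightarrow> signed_perm \<Rightarrow> (nat \<Rightarrow> real) \<Rightarrow> nat \<Rightarrow> real" where
  "act n w x = (\<lambda>i. if i \<in> {1..n}
                    then (if i \<in> snd w then 1 - x (fst w i) else x (fst w i))
                    else 0)"

definition stabilizer :: "nat \<Rightarrow> (nat \<Rightarrow> real) set \<Rightarrow> signed_perm set" where
  "stabilizer n H = {w \<in> signed_perms {1..n}. act n w ` H = H}"

text \<open>
  The type \<open>(\<alpha>\<^sub>1, \<dots>, \<alpha>\<^sub>\<ell>)\<close> is a list of length \<open>\<ell> = a t\<close>; list positions count from 0, so
  \<open>\<alpha>\<^sub>i\<close> is \<open>\<alpha> ! (i - 1)\<close> and \<open>\<alpha>\<^sub>1 + \<dots> + \<alpha>\<^sub>i\<close> is \<open>sum_list (take i \<alpha>)\<close>.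
\<close>

definition hyperplane_type :: "nat \<Rightarrow> (nat \<Rightarrow> nat) \<Rightarrow> nat list" where
  "hyperplane_type t a = map (\<lambda>i. card {j \<in> {1..t}. a j = i}) [1..<Suc (a t)]"

definition block :: "nat list \<Rightarrow> nat \<Rightarrow> nat set" where
  "block \<alpha> i = {sum_list (take (i - 1) \<alpha>) + 1 .. sum_list (take i \<alpha>)}"

definition young_perms :: "nat \<Rightarrow> nat list \<Rightarrow> (nat \<Rightarrow> nat) set" where
  "young_perms t \<alpha> =
     {\<pi>. \<pi> permutes {1..t} \<and> (\<forall>i\<in>{1..length \<alpha>}. \<pi> ` block \<alpha> i = block \<alpha> i)}"

definition young :: "nat \<Rightarrow> nat list \<Rightarrow> signed_perm set" where
  "young t \<alpha> = {(\<pi>, {}) | \<pi>. \<pi> \<in> young_perms t \<alpha>}"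

definition neg_young :: "nat \<Rightarrow> nat list \<Rightarrow> signed_perm set" where
  "neg_young t \<alpha> = {(\<pi>, {1..t}) | \<pi>. \<pi> \<in> young_perms t \<alpha>}"

definition P_part :: "nat \<Rightarrow> (nat \<Rightarrow> nat) \<Rightarrow> nat \<Rightarrow> signed_perm set" where
  "P_part t a b =
     (if (\<Sum>i = 1..t. a i) \<noteq> 2 * b then young t (hyperplane_type t a)
      else young t (hyperplane_type t a) \<union> neg_young t (hyperplane_type t a))"

definition combine :: "nat \<Rightarrow> signed_perm \<Rightarrow> signed_perm \<Rightarrow> signed_perm" where
  "combine t u v = (\<lambda>i. if i \<le> t then fst u i else fst v i, snd u \<union> snd v)"

text \<open>For \<open>U\<close> and \<open>V\<close> consisting of signed permutations of \<open>{1..t}\<close> and of \<open>{t+1..n}\<close>.\<close>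

definition sp_prod :: "nat \<Rightarrow> signed_perm set \<Rightarrow> signed_perm set \<Rightarrow> signed_perm set" where
  "sp_prod t U V = {combine t u v | u v. u \<in> U \<and> v \<in> V}"

end

theory Submission
  imports Defs
begin

text \<open>
  Let \<open>c \<ge> 0\<close> be the normal vector of \<open>H\<close>. If \<open>w = (\<pi>, N)\<close> maps \<open>H\<close> into itself, then pulling back
  the equation of \<open>H\<close> along \<open>w\<close> gives an affine function that is constant on \<open>H\<close>. Evaluating it at
  the points where \<open>H\<close> meets the coordinate axes, and at their translates by the directions
  \<open>e\<^sub>k\<close> with \<open>c\<^sub>k = 0\<close>, shows that the signed and permuted normal vector is \<open>\<lambda>\<close> times \<open>c\<close>. Both
  vectors have the same sum of absolute values, so \<open>\<lambda> = \<plusminus>1\<close>: either \<open>w\<close> has only plus signs on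
  the support of \<open>c\<close>, or only minus signs, and the latter forces the entries of \<open>c\<close> to sum to
  twice the right-hand side.
\<close>

section \<open>The action of signed permutations on points and linear forms\<close>

text \<open>Each \<open>i\<close> in \<open>N\<close> contributes
  \<open>c i * (1 - x (\<pi> i))\<close>: its coefficient changes sign and the constant
  \<open>c i\<close> splits off.\<close>

lemma sum_act:
  fixes c :: "nat \<Rightarrow> real"
  assumes "N \<subseteq> {1..n}"
  shows "(\<Sum>i = 1..n. c i * act n (\<pi>, N) x i) =
         (\<Sum>i = 1..n. (if i \<in> N then - c i else c i) * x (\<pi> i)) + sum c N"
proof -
  have "sum c N = (\<Sum>i = 1..n. if i \<in> N then c i else 0)"
    using assms by (simp add: sum.inter_restrict[symmetric] Int_absorb1)
  then show ?thesis
    by (auto simp: sum.distrib[symmetric] act_def algebra_simps intro!: sum.cong)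
qed

text \<open>The inner signed permutation is the inverse of \<open>(\<pi>, N)\<close>: coordinate
  \<open>i\<close> is read from position \<open>\<pi> i\<close>, so the sign set must be moved along
  \<open>\<pi>\<close>.\<close>

lemma act_inverse:
  assumes "(\<pi>, N) \<in> signed_perms {1..n}" and "y \<in> Rn n"
  shows "act n (\<pi>, N) (act n (inv \<pi>, \<pi> ` N) y) = y"
proof
  fix i
  have p: "\<pi> permutes {1..n}" using assms(1) by (simp add: signed_perms_def)
  have "inj \<pi>" using p by (rule permutes_inj)
  then show "act n (\<pi>, N) (act n (inv \<pi>, \<pi> ` N) y) i = y i"
    using permutes_in_image[OF p, of i] assms(2)
    by (auto simp: act_def Rn_def inj_image_mem_iff permutes_inverses[OF p])
qed

lemma act_in_Rn: "act n w x \<in> Rn n"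
  by (simp add: act_def Rn_def)

text \<open>Every point of \<open>H\<close> has an explicit preimage in \<open>Rn n\<close>, given
  by the inverse; the equivalence then places that preimage in \<open>H\<close>.\<close>

lemma act_image_eqI:
  assumes w: "w \<in> signed_perms {1..n}" and "H \<subseteq> Rn n"
    and iff: "\<And>x. x \<in> Rn n \<Longrightarrow> act n w x \<in> H \<longleftrightarrow> x \<in> H"
  shows "act n w ` H = H"
proof
  show "act n w ` H \<subseteq> H" using assms by blast
next
  obtain \<pi> N where pN: "w = (\<pi>, N)" by fastforce
  show "H \<subseteq> act n w ` H"
  proof
    fix y assume y: "y \<in> H"
    let ?x = "act n (inv \<pi>, \<pi> ` N) y"
    have "act n w ?x = y" using act_inverse w y assms(2) pN by blast
    with iff[of ?x] y act_in_Rn show "y \<in> act n w ` H" by (metis imageI)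
  qed
qed

section \<open>The stabilizer of a hyperplane in terms of its normal vector\<close>

text \<open>The pulled-back form takes the constant value \<open>\<beta> - sum c N\<close> on
  \<open>H\<close>, where the original form takes the value \<open>\<beta>\<close>; this fixes the
  factor of proportionality.\<close>

lemma act_normal_proportional:
  fixes c :: "nat \<Rightarrow> real" and \<beta> :: real
  assumes w: "(\<pi>, N) \<in> signed_perms {1..n}"
    and "0 < \<beta>" and "k0 \<in> {1..n}" and "c k0 \<noteq> 0"
    and H: "H = {x \<in> Rn n. (\<Sum>i = 1..n. c i * x i) = \<beta>}"
    and sub: "act n (\<pi>, N) ` H \<subseteq> H"
    and i: "i \<in> {1..n}"
  shows "(if i \<in> N then - c i else c i) = (\<beta> - sum c N) / \<beta> * c (\<pi> i)"
proof -
  have p: "\<pi> permutes {1..n}" and N: "N \<subseteq> {1..n}" using w by (auto simp: signed_perms_def)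
  define d where "d i = (if i \<in> N then - c i else c i)" for i
  have eq: "(\<Sum>i = 1..n. d i * x (\<pi> i)) = \<beta> - sum c N" if "x \<in> H" for x
  proof -
    have "act n (\<pi>, N) x \<in> H" using that sub by blast
    then show ?thesis using sum_act[OF N, of c \<pi> x] by (simp add: H d_def)
  qed
  define e where "e k r = (\<lambda>j. if j = k then r else 0)" for k :: nat and r :: real
  have sum_e: "(\<Sum>i = 1..n. f i * e k r i) = f k * r" if "k \<in> {1..n}" for f k r
    using that by (simp add: e_def sum.delta if_distrib cong: if_cong)
  have "(\<Sum>j = 1..n. d j * e (\<pi> i) r (\<pi> j)) = (\<Sum>j = 1..n. d j * e i r j)" for r
    using permutes_inj[OF p] by (intro sum.cong) (auto simp: e_def inj_eq)
  then have sum_d: "(\<Sum>j = 1..n. d j * e (\<pi> i) r (\<pi> j)) = d i * r" for r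
    using i by (simp only: sum_e)
  have pi: "\<pi> i \<in> {1..n}" using permutes_in_image[OF p] i by blast
  have axis: "e k (\<beta> / c k) \<in> H" if "k \<in> {1..n}" "c k \<noteq> 0" for k
    using that sum_e[of k c] by (auto simp: H Rn_def e_def)
  have "d i = (\<beta> - sum c N) / \<beta> * c (\<pi> i)"
  proof (cases "c (\<pi> i) = 0")
    case False
    with eq[OF axis[OF pi]] sum_d have "d i * (\<beta> / c (\<pi> i)) = \<beta> - sum c N" by simp
    then show ?thesis using False \<open>0 < \<beta>\<close> by (simp add: field_simps)
  next
    case True
    \<comment> \<open>The axis of \<open>\<pi> i\<close> misses \<open>H\<close>, but its direction
      is parallel to \<open>H\<close>. Two points of \<open>H\<close> that differ by this unit
      vector force \<open>d i = 0\<close>; \<open>k0\<close> supplies the first of them.\<close>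
    let ?x = "e k0 (\<beta> / c k0)"
    let ?z = "\<lambda>j. ?x j + e (\<pi> i) 1 j"
    have x: "?x \<in> H" using axis assms by blast
    have "?z \<in> Rn n" using x pi by (auto simp: H Rn_def e_def)
    moreover have "(\<Sum>j = 1..n. c j * ?z j) = \<beta>"
      using x True sum_e[OF pi, of c 1] by (simp add: distrib_left sum.distrib H)
    ultimately have "?z \<in> H" by (simp add: H)
    from eq[OF this] eq[OF x] sum_d[of 1] True show ?thesis
      by (simp add: distrib_left sum.distrib)
  qed
  then show ?thesis by (simp add: d_def)
qed

lemma act_image_hyperplane_iff:
  fixes c :: "nat \<Rightarrow> real" and \<beta> :: real
  assumes w: "(\<pi>, N) \<in> signed_perms {1..n}"
    and c: "\<And>i. 0 \<le> c i" and "0 < \<beta>" and k0: "k0 \<in> {1..n}" "c k0 \<noteq> 0"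
    and H: "H = {x \<in> Rn n. (\<Sum>i = 1..n. c i * x i) = \<beta>}"
  shows "act n (\<pi>, N) ` H = H \<longleftrightarrow>
    (\<forall>i\<in>{1..n}. c (\<pi> i) = c i) \<and>
    ((\<forall>i\<in>{1..n}. c i \<noteq> 0 \<longrightarrow> i \<notin> N) \<or>
     (\<forall>i\<in>{1..n}. c i \<noteq> 0 \<longrightarrow> i \<in> N) \<and> (\<Sum>i = 1..n. c i) = 2 * \<beta>)"
    (is "_ \<longleftrightarrow> ?inv \<and> (?plus \<or> ?minus \<and> ?mid)")
proof
  have p: "\<pi> permutes {1..n}" and N: "N \<subseteq> {1..n}" using w by (auto simp: signed_perms_def)
  have perm: "(\<Sum>i = 1..n. f (\<pi> i)) = (\<Sum>i = 1..n. f i)" for f :: "nat \<Rightarrow> real"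
    using sum.permute[OF p, of f] by (simp add: comp_def)
  have sumN: "sum c N = (\<Sum>i = 1..n. c i)" if ?minus
    using that N by (intro sum.mono_neutral_left) auto
  {
    assume "act n (\<pi>, N) ` H = H"
    then have sub: "act n (\<pi>, N) ` H \<subseteq> H" by simp
    define l where "l = (\<beta> - sum c N) / \<beta>"
    have l: "(if i \<in> N then - c i else c i) = l * c (\<pi> i)" if "i \<in> {1..n}" for i
      unfolding l_def using act_normal_proportional[OF w \<open>0 < \<beta>\<close> k0 H sub that] .
    \<comment> \<open>Since \<open>c\<close> is nonnegative, absolute values erase the
      signs.\<close>
    have abs_l: "c i = \<bar>l\<bar> * c (\<pi> i)" if "i \<in> {1..n}" for i
    proof -
      have "c i = \<bar>if i \<in> N then - c i else c i\<bar>" using c[of i] by simp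
      then show ?thesis using l[OF that] c[of "\<pi> i"] by (simp add: abs_mult)
    qed
    \<comment> \<open>A positive total can be cancelled below, which leaves
      \<open>\<bar>l\<bar> = 1\<close>.\<close>
    have "0 < (\<Sum>i = 1..n. c i)"
      using k0 c by (intro sum_pos2[where i = k0]) (auto simp: order_less_le)
    moreover have "(\<Sum>i = 1..n. c i) = \<bar>l\<bar> * (\<Sum>i = 1..n. c i)"
    proof -
      have "(\<Sum>i = 1..n. c i) = (\<Sum>i = 1..n. \<bar>l\<bar> * c (\<pi> i))"
        using abs_l by (rule sum.cong[OF refl])
      then show ?thesis using perm[of c] by (simp only: sum_distrib_left[symmetric])
    qed
    ultimately have l1: "\<bar>l\<bar> = 1" by simp
    have inv: ?inv
    proof
      fix i assume "i \<in> {1..n}"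
      from abs_l[OF this] show "c (\<pi> i) = c i" by (simp only: l1 mult_1)
    qed
    \<comment> \<open>The factor \<open>l\<close> is the same for all \<open>i\<close>, so the signs
      agree on the whole support of \<open>c\<close>.\<close>
    have signed: "(if i \<in> N then - c i else c i) = l * c i" if "i \<in> {1..n}" for i
      using l[OF that] inv that by metis
    have "?plus \<or> ?minus \<and> ?mid"
    proof (cases "l = 1")
      case True
      have "i \<notin> N" if "i \<in> {1..n}" "c i \<noteq> 0" for i
        using signed[OF that(1)] that(2) True by (cases "i \<in> N") auto
      then have ?plus by blast
      then show ?thesis by simp
    next
      case False
      then have "l = -1" using l1 by linarith
      have "i \<in> N" if "i \<in> {1..n}" "c i \<noteq> 0" for i
        using signed[OF that(1)] that(2) \<open>l = -1\<close> by (cases "i \<in> N") auto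
      then have ?minus by blast
      moreover have "sum c N = 2 * \<beta>"
        using \<open>l = -1\<close> \<open>0 < \<beta>\<close> by (simp add: l_def field_simps)
      ultimately show ?thesis using sumN by simp
    qed
    with inv show "?inv \<and> (?plus \<or> ?minus \<and> ?mid)" by blast
  }
  assume R: "?inv \<and> (?plus \<or> ?minus \<and> ?mid)"
  have act_sum: "(\<Sum>i = 1..n. c i * act n (\<pi>, N) x i) = \<beta> \<longleftrightarrow> (\<Sum>i = 1..n. c i * x i) = \<beta>"
    for x
  proof -
    have inv: "(\<Sum>i = 1..n. c i * x (\<pi> i)) = (\<Sum>i = 1..n. c i * x i)"
    proof -
      have "(\<Sum>i = 1..n. c i * x (\<pi> i)) = (\<Sum>i = 1..n. c (\<pi> i) * x (\<pi> i))"
        using R by (intro sum.cong) auto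
      then show ?thesis by (simp only: perm[of "\<lambda>i. c i * x i"])
    qed
    from R consider ?plus | ?minus ?mid by blast
    then show ?thesis
    proof cases
      case 1
      then have "(\<Sum>i = 1..n. (if i \<in> N then - c i else c i) * x (\<pi> i)) =
          (\<Sum>i = 1..n. c i * x (\<pi> i))"
        by (intro sum.cong) auto
      moreover have "sum c N = 0" using 1 N by (intro sum.neutral) auto
      ultimately show ?thesis unfolding sum_act[OF N] using inv by simp
    next
      case 2
      then have "(\<Sum>i = 1..n. (if i \<in> N then - c i else c i) * x (\<pi> i)) =
          (\<Sum>i = 1..n. - (c i * x (\<pi> i)))"
        by (intro sum.cong) auto
      \<comment> \<open>With \<open>s\<close> the value of the form at \<open>x\<close>, its value
        at the image is \<open>2 * \<beta> - s\<close>, which is \<open>\<beta>\<close> exactly when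
        \<open>s\<close> is.\<close>
      then show ?thesis
        unfolding sum_act[OF N] using inv 2(2) sumN[OF 2(1)] by (auto simp: sum_negf)
    qed
  qed
  show "act n (\<pi>, N) ` H = H"
  proof (rule act_image_eqI[OF w])
    show "H \<subseteq> Rn n" by (auto simp: H)
    show "act n (\<pi>, N) x \<in> H \<longleftrightarrow> x \<in> H" if "x \<in> Rn n" for x
      unfolding H mem_Collect_eq act_sum using that act_in_Rn by blast
  qed
qed

section \<open>The type and its Young subgroup\<close>

text \<open>The entries count disjoint level sets of \<open>a\<close>, so partial sums count
  sublevel sets; positivity makes the sublevel set at 0 empty.\<close>

lemma sum_list_take_hyperplane_type:
  assumes "\<forall>i\<in>{1..t}. 0 < a i" and "k \<le> a t"
  shows "sum_list (take k (hyperplane_type t a)) = card {j \<in> {1..t}. a j \<le> k}"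
  using assms(2)
proof (induction k)
  case 0
  have "{j \<in> {1..t}. a j \<le> 0} = {}" using assms(1) by auto
  then show ?case by simp
next
  case (Suc k)
  \<comment> \<open>List positions start at 0 but values at 1, so position \<open>k\<close> counts
    the value \<open>Suc k\<close>.\<close>
  have "take (Suc k) (hyperplane_type t a) =
      take k (hyperplane_type t a) @ [card {j \<in> {1..t}. a j = Suc k}]"
    using Suc.prems
    by (subst take_Suc_conv_app_nth) (simp_all add: hyperplane_type_def nth_append del: upt_Suc)
  moreover have "{j \<in> {1..t}. a j \<le> Suc k} = {j \<in> {1..t}. a j \<le> k} \<union> {j \<in> {1..t}. a j = Suc k}"
    by auto
  ultimately show ?case
    using Suc by (simp add: card_Un_disjoint disjoint_iff)
qed

text \<open>By monotonicity a sublevel set is closed downwards in \<open>{1..t}\<close>, hence runs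
  from 1 to its maximum, which is then its cardinality.\<close>

lemma sublevel_set_eq_segment:
  fixes a :: "nat \<Rightarrow> nat"
  assumes "mono_on {1..t} a"
  shows "{j \<in> {1..t}. a j \<le> k} = {1..card {j \<in> {1..t}. a j \<le> k}}"
proof -
  let ?S = "{j \<in> {1..t}. a j \<le> k}"
  obtain m where m: "?S = {1..m}"
  proof (cases "?S = {}")
    case True
    then show ?thesis using that[of 0] by simp
  next
    case False
    have "Max ?S \<in> ?S" by (rule Max_in) (use False in auto)
    have "?S \<subseteq> {1..Max ?S}"
    proof
      fix j assume j: "j \<in> ?S"
      then have "j \<le> Max ?S" by (intro Max_ge) auto
      with j show "j \<in> {1..Max ?S}" by simp
    qed
    moreover have "j \<in> ?S" if "j \<in> {1..Max ?S}" for j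
      using that \<open>Max ?S \<in> ?S\<close> mono_onD[OF assms, of j "Max ?S"] by auto
    ultimately have "?S = {1..Max ?S}" by blast
    then show ?thesis by (rule that)
  qed
  moreover have "card ?S = m" unfolding m by simp
  ultimately show ?thesis by (simp only:)
qed

text \<open>A block is the difference of two initial segments, the sublevel sets at \<open>i\<close>
  and at \<open>i - 1\<close>.\<close>

lemma block_hyperplane_type:
  assumes pos: "\<forall>i\<in>{1..t}. 0 < a i" and mono: "mono_on {1..t} a" and i: "i \<in> {1..a t}"
  shows "block (hyperplane_type t a) i = {j \<in> {1..t}. a j = i}"
proof -
  let ?m = "\<lambda>k. card {j \<in> {1..t}. a j \<le> k}"
  have seg: "j \<in> {1..t} \<and> a j \<le> k \<longleftrightarrow> 1 \<le> j \<and> j \<le> ?m k" for j k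
    using arg_cong[OF sublevel_set_eq_segment[OF mono, of k], of "\<lambda>S. j \<in> S"]
    by (simp only: mem_Collect_eq atLeastAtMost_iff)
  have "block (hyperplane_type t a) i = {?m (i - 1) + 1..?m i}"
    unfolding block_def using i
    by (subst (1 2) sum_list_take_hyperplane_type[OF pos]) auto
  also have "\<dots> = {j \<in> {1..t}. a j = i}"
  proof (rule set_eqI)
    fix j
    have "j \<in> {?m (i - 1) + 1..?m i} \<longleftrightarrow>
        (1 \<le> j \<and> j \<le> ?m i) \<and> \<not> (1 \<le> j \<and> j \<le> ?m (i - 1))"
      by auto
    also have "\<dots> \<longleftrightarrow> (j \<in> {1..t} \<and> a j \<le> i) \<and> \<not> (j \<in> {1..t} \<and> a j \<le> i - 1)"
      by (simp only: seg[of j])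
    \<comment> \<open>Here \<open>1 \<le> i\<close> matters: \<open>i - 1\<close> is a true
      predecessor and not a truncated difference.\<close>
    also have "\<dots> \<longleftrightarrow> j \<in> {j \<in> {1..t}. a j = i}" using i by auto
    finally show "j \<in> {?m (i - 1) + 1..?m i} \<longleftrightarrow> j \<in> {j \<in> {1..t}. a j = i}" .
  qed
  finally show ?thesis .
qed

text \<open>The blocks are the level sets of \<open>a\<close>, so preserving every block amounts to
  preserving the values of \<open>a\<close>.\<close>

lemma young_perms_hyperplane_type:
  assumes pos: "\<forall>i\<in>{1..t}. 0 < a i" and mono: "mono_on {1..t} a"
  shows "young_perms t (hyperplane_type t a) =
    {\<pi>. \<pi> permutes {1..t} \<and> (\<forall>j\<in>{1..t}. a (\<pi> j) = a j)}"
proof -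
  have range: "a j \<in> {1..a t}" if "j \<in> {1..t}" for j
    using that pos mono_onD[OF mono, of j t] by (auto simp: Suc_le_eq)
  have "(\<forall>i\<in>{1..a t}. \<pi> ` {j \<in> {1..t}. a j = i} = {j \<in> {1..t}. a j = i}) \<longleftrightarrow>
      (\<forall>j\<in>{1..t}. a (\<pi> j) = a j)" (is "?L \<longleftrightarrow> ?R") if p: "\<pi> permutes {1..t}" for \<pi>
  proof
    assume ?L
    then show ?R using range by blast
  next
    assume R: ?R
    show ?L
    proof
      fix i
      \<comment> \<open>Inclusion suffices: an injective self-map of a finite set is onto.\<close>
      have "\<pi> ` {j \<in> {1..t}. a j = i} \<subseteq> {j \<in> {1..t}. a j = i}"
        using R permutes_in_image[OF p] by auto
      then show "\<pi> ` {j \<in> {1..t}. a j = i} = {j \<in> {1..t}. a j = i}"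
        using permutes_inj[OF p] by (intro endo_inj_surj) (auto intro: inj_on_subset)
    qed
  qed
  moreover have "length (hyperplane_type t a) = a t" by (simp add: hyperplane_type_def)
  ultimately show ?thesis
    using block_hyperplane_type[OF pos mono] by (auto simp: young_perms_def)
qed

lemma P_part_iff:
  assumes "\<forall>i\<in>{1..t}. 0 < a i" and "mono_on {1..t} a"
  shows "(\<pi>, N) \<in> P_part t a b \<longleftrightarrow>
    \<pi> permutes {1..t} \<and> (\<forall>j\<in>{1..t}. a (\<pi> j) = a j) \<and>
    (N = {} \<or> N = {1..t} \<and> (\<Sum>i = 1..t. a i) = 2 * b)"
  by (auto simp: P_part_def young_def neg_young_def young_perms_hyperplane_type[OF assms])

section \<open>Membership in the product of two groups of signed permutations\<close>

text \<open>The first factor is recovered by truncation to \<open>{1..t}\<close>. If the truncated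
  map permutes \<open>{1..t}\<close>, the rest of \<open>\<pi>\<close> permutes
  \<open>{t+1..n}\<close>, and the second factor admits every such signed permutation.\<close>

lemma sp_prod_signed_perms_iff:
  assumes U: "U \<subseteq> signed_perms {1..t}" and "t \<le> n"
  shows "(\<pi>, N) \<in> sp_prod t U (signed_perms {t+1..n}) \<longleftrightarrow>
    (\<pi>, N) \<in> signed_perms {1..n} \<and> (\<lambda>i. if i \<le> t then \<pi> i else i, N \<inter> {1..t}) \<in> U"
    (is "?L \<longleftrightarrow> ?R")
proof
  assume ?L
  then obtain \<sigma> M \<tau> K where u: "(\<sigma>, M) \<in> U" and v: "(\<tau>, K) \<in> signed_perms {t+1..n}"
    and w: "(\<pi>, N) = combine t (\<sigma>, M) (\<tau>, K)"
    by (auto simp: sp_prod_def)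
  have s: "\<sigma> permutes {1..t}" "M \<subseteq> {1..t}" using u U by (auto simp: signed_perms_def)
  have r: "\<tau> permutes {t+1..n}" "K \<subseteq> {t+1..n}" using v by (auto simp: signed_perms_def)
  have pi: "\<pi> = (\<lambda>i. if i \<le> t then \<sigma> i else \<tau> i)" and N: "N = M \<union> K"
    using w by (auto simp: combine_def)
  \<comment> \<open>The supports are disjoint, so gluing is composition, and \<open>\<pi>\<close>
    inherits being a permutation.\<close>
  have "\<pi> = \<sigma> \<circ> \<tau>"
  proof
    fix i
    show "\<pi> i = (\<sigma> \<circ> \<tau>) i"
    proof (cases "i \<le> t")
      case True
      then show ?thesis using permutes_not_in[OF r(1), of i] by (simp add: pi)
    next
      case False
      then have "\<tau> i \<notin> {1..t}"
        using permutes_in_image[OF r(1), of i] permutes_not_in[OF r(1), of i]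
        by (cases "i \<in> {t+1..n}") auto
      then show ?thesis using False permutes_not_in[OF s(1)] by (simp add: pi)
    qed
  qed
  moreover have "\<sigma> permutes {1..n}" "\<tau> permutes {1..n}"
    using s r \<open>t \<le> n\<close> by (auto intro: permutes_subset)
  ultimately have "\<pi> permutes {1..n}" by (simp add: permutes_compose)
  moreover have "N \<subseteq> {1..n}" using s r N \<open>t \<le> n\<close> by fastforce
  moreover have "(\<lambda>i. if i \<le> t then \<pi> i else i) = \<sigma>"
    using permutes_not_in[OF s(1)] by (auto simp: pi)
  moreover have "N \<inter> {1..t} = M" using s r N by auto
  ultimately show ?R using u by (simp add: signed_perms_def)
next
  assume R: ?R
  define \<sigma> where "\<sigma> i = (if i \<le> t then \<pi> i else i)" for i
  \<comment> \<open>Dividing \<open>\<pi>\<close> by its first factor leaves a permutation that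
    fixes everything up to \<open>t\<close>.\<close>
  define \<tau> where "\<tau> = inv \<sigma> \<circ> \<pi>"
  have u: "(\<sigma>, N \<inter> {1..t}) \<in> U" using R by (simp add: \<sigma>_def[abs_def])
  have p: "\<pi> permutes {1..n}" and N: "N \<subseteq> {1..n}" using R by (auto simp: signed_perms_def)
  have s: "\<sigma> permutes {1..t}" using u U by (auto simp: signed_perms_def)
  have fixed: "\<tau> i = i" if "i \<le> t" for i
  proof -
    have "\<pi> i = \<sigma> i" using that by (simp add: \<sigma>_def)
    then show ?thesis by (simp add: \<tau>_def permutes_inverses[OF s])
  qed
  have "\<tau> permutes {1..n}"
    unfolding \<tau>_def using s \<open>t \<le> n\<close>
    by (intro permutes_compose[OF p] permutes_inv) (auto intro: permutes_subset)
  then have r: "\<tau> permutes {t+1..n}"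
    by (rule permutes_superset) (use fixed in auto)
  have "\<tau> i = \<pi> i" if "\<not> i \<le> t" for i
  proof -
    have "\<tau> i \<notin> {1..t}"
      using that permutes_in_image[OF r, of i] permutes_not_in[OF r, of i]
      by (cases "i \<in> {t+1..n}") auto
    moreover have "\<sigma> (\<tau> i) = \<pi> i" by (simp add: \<tau>_def permutes_inverses[OF s])
    ultimately show ?thesis using permutes_not_in[OF s, of "\<tau> i"] by simp
  qed
  then have "(\<pi>, N) = combine t (\<sigma>, N \<inter> {1..t}) (\<tau>, N \<inter> {t+1..n})"
    using N by (auto simp: combine_def \<sigma>_def fun_eq_iff)
  moreover have "(\<tau>, N \<inter> {t+1..n}) \<in> signed_perms {t+1..n}"
    using r by (simp add: signed_perms_def)
  ultimately show ?L using u unfolding sp_prod_def by blast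
qed

section \<open>The stabilizer as a product\<close>

theorem theorem5p2:
  fixes n t b :: nat and a :: "nat \<Rightarrow> nat" and H :: "(nat \<Rightarrow> real) set"
  assumes "1 \<le> t" and "t \<le> n"
    and "\<forall>i\<in>{1..t}. 0 < a i" and "0 < b"
    and "mono_on {1..t} a"
    and "H = {x \<in> Rn n. (\<Sum>i = 1..t. real (a i) * x i) = real b}"
    and "spanned_hyperplane n H"
  shows "stabilizer n H = sp_prod t (P_part t a b) (signed_perms {t+1..n})"
proof -
  note pos = assms(3) and P_iff = P_part_iff[OF assms(3,5)]
  \<comment> \<open>Extending \<open>a\<close> by zero writes \<open>H\<close> with all
    \<open>n\<close> coordinates; the support of \<open>c\<close> is exactly
    \<open>{1..t}\<close>.\<close>
  define c :: "nat \<Rightarrow> real" where "c i = (if i \<in> {1..t} then real (a i) else 0)" for i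
  have sum_c: "(\<Sum>i = 1..n. c i * f i) = (\<Sum>i = 1..t. real (a i) * f i)" for f
    using \<open>t \<le> n\<close> by (intro sum.mono_neutral_cong_right) (auto simp: c_def)
  have H: "H = {x \<in> Rn n. (\<Sum>i = 1..n. c i * x i) = real b}"
    unfolding sum_c by (rule assms(6))
  have c_nz: "c i \<noteq> 0 \<longleftrightarrow> i \<in> {1..t}" for i using pos by (auto simp: c_def)
  have mid: "(\<Sum>i = 1..n. c i) = 2 * real b \<longleftrightarrow> (\<Sum>i = 1..t. a i) = 2 * b"
  proof -
    have "(\<Sum>i = 1..n. c i) = real (\<Sum>i = 1..t. a i)" using sum_c[of "\<lambda>_. 1"] by simp
    then show ?thesis by linarith
  qed
  have "P_part t a b \<subseteq> signed_perms {1..t}"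
    using P_iff by (auto simp: signed_perms_def)
  note prod_iff = sp_prod_signed_perms_iff[OF this \<open>t \<le> n\<close>]
  have "(\<pi>, N) \<in> stabilizer n H \<longleftrightarrow>
      (\<pi>, N) \<in> sp_prod t (P_part t a b) (signed_perms {t+1..n})" for \<pi> N
  proof (cases "(\<pi>, N) \<in> signed_perms {1..n}")
    case False
    then show ?thesis unfolding prod_iff by (simp add: stabilizer_def)
  next
    case True
    then have p: "\<pi> permutes {1..n}" by (simp add: signed_perms_def)
    let ?\<sigma> = "\<lambda>i. if i \<le> t then \<pi> i else i"
    have "act n (\<pi>, N) ` H = H \<longleftrightarrow>
        (\<forall>i\<in>{1..n}. c (\<pi> i) = c i) \<and>
        ((\<forall>i\<in>{1..n}. c i \<noteq> 0 \<longrightarrow> i \<notin> N) \<or>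
         (\<forall>i\<in>{1..n}. c i \<noteq> 0 \<longrightarrow> i \<in> N) \<and> (\<Sum>i = 1..n. c i) = 2 * real b)"
      \<comment> \<open>Index 1 witnesses a nonzero coefficient, because \<open>1 \<le> t\<close>
        and \<open>a 1\<close> is positive.\<close>
      by (rule act_image_hyperplane_iff[OF True _ _ _ _ H, of 1])
        (use assms c_nz[of 1] in \<open>auto simp: c_def\<close>)
    \<comment> \<open>Invariance of \<open>c\<close> encodes two facts: \<open>\<pi>\<close>
      preserves the support \<open>{1..t}\<close>, and it preserves the values of \<open>a\<close>
      there.\<close>
    also have "(\<forall>i\<in>{1..n}. c (\<pi> i) = c i) \<longleftrightarrow>
        ?\<sigma> permutes {1..t} \<and> (\<forall>j\<in>{1..t}. a (?\<sigma> j) = a j)"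
    proof
      assume inv: "\<forall>i\<in>{1..n}. c (\<pi> i) = c i"
      have maps: "\<pi> i \<in> {1..t}" if "i \<in> {1..t}" for i
        using inv that \<open>t \<le> n\<close> c_nz[of i] c_nz[of "\<pi> i"] by auto
      have "inj_on \<pi> {1..t}" using permutes_inj[OF p] by (rule inj_on_subset) simp
      moreover have "\<pi> ` {1..t} = {1..t}"
        using maps \<open>inj_on \<pi> {1..t}\<close> by (intro endo_inj_surj) auto
      ultimately have "bij_betw \<pi> {1..t} {1..t}" by (rule bij_betw_imageI)
      then have "bij_betw ?\<sigma> {1..t} {1..t}"
        by (rule bij_betw_cong[THEN iffD1, rotated]) simp
      moreover have "?\<sigma> i = i" if "i \<notin> {1..t}" for i
        using that permutes_not_in[OF p, of i] by auto
      ultimately have "?\<sigma> permutes {1..t}" by (rule bij_imp_permutes)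
      moreover have "a (?\<sigma> j) = a j" if "j \<in> {1..t}" for j
      proof -
        have "c (\<pi> j) = c j" using inv that \<open>t \<le> n\<close> by auto
        then show ?thesis using maps[OF that] that by (simp add: c_def)
      qed
      ultimately show "?\<sigma> permutes {1..t} \<and> (\<forall>j\<in>{1..t}. a (?\<sigma> j) = a j)" by blast
    next
      assume A: "?\<sigma> permutes {1..t} \<and> (\<forall>j\<in>{1..t}. a (?\<sigma> j) = a j)"
      then have s: "?\<sigma> permutes {1..t}" ..
      have maps: "\<pi> i \<in> {1..t}" if "i \<in> {1..t}" for i
        using permutes_in_image[OF s, of i] that by auto
      have "\<pi> ` {1..t} = {1..t}"
        using maps permutes_inj[OF p] by (intro endo_inj_surj) (auto intro: inj_on_subset)
      \<comment> \<open>By injectivity the complement of \<open>{1..t}\<close> is preserved too, and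
        \<open>c\<close> vanishes there.\<close>
      then have mem: "\<pi> i \<in> {1..t} \<longleftrightarrow> i \<in> {1..t}" for i
        using permutes_inj[OF p] by (metis inj_image_mem_iff)
      have "a (\<pi> i) = a i" if "i \<in> {1..t}" for i using A that by auto
      then show "\<forall>i\<in>{1..n}. c (\<pi> i) = c i" using mem by (simp add: c_def)
    qed
    \<comment> \<open>Only the signs on the support are constrained; those above \<open>t\<close>
      belong to the second factor.\<close>
    also have "(\<forall>i\<in>{1..n}. c i \<noteq> 0 \<longrightarrow> i \<notin> N) \<longleftrightarrow> N \<inter> {1..t} = {}"
      using c_nz \<open>t \<le> n\<close> by auto
    also have "(\<forall>i\<in>{1..n}. c i \<noteq> 0 \<longrightarrow> i \<in> N) \<longleftrightarrow> N \<inter> {1..t} = {1..t}"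
      using c_nz \<open>t \<le> n\<close> by auto
    finally show ?thesis
      unfolding prod_iff P_iff mid using True by (simp add: stabilizer_def)
  qed
  then show ?thesis by auto
qed

end
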